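(* Let $1<\alpha\le 2$. Then there exists a positive random variable $T_\alpha$ satisfying $$ \mathbb{E}[T_\alpha^{s}]=\frac{\Gamma(\frac12)\Gamma(\frac12)}{\Gamma(\frac1\alpha)\Gamma(1-\frac1\alpha)}\;\frac{\Gamma(\frac1\alpha+\frac{2s}{\alpha})\,\Gamma(1-\frac1\alpha-\frac{2s}{\alpha})}{\Gamma(\frac12+s)\,\Gamma(\frac12-s)},\qquad -\frac12<s<\frac{\alpha-1}{2}, $$ such that the $\alpha$-Cauchy variable $\mathcal{C}_\alpha$ is proportional to $$ Z\times\sqrt{\mathbf{\Gamma}_{1/2}^{-1}\times T_\alpha}, $$ that is, $\mathcal{C}_\alpha$ has the same distribution as a positive constant times this product, where $Z$, $\mathbf{\Gamma}_{1/2}$ and $T_\alpha$ are independent.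
   Context: For $\alpha>1$, the $\alpha$-Cauchy variable $\mathcal{C}_\alpha$ is a real random variable with density $f_{\mathcal{C}_\alpha}(x)=\frac{\sin(\pi/\alpha)}{2\pi/\alpha}\frac{1}{1+|x|^\alpha}$, $x\in\mathbb{R}$. $Z$ denotes a standard normal random variable $N(0,1)$. For $c>0$, $\mathbf{\Gamma}_c$ denotes a Gamma random variable with density $\frac{1}{\Gamma(c)}x^{c-1}e^{-x}\mathbf{1}_{(0,\infty)}(x)$. $\Gamma(\cdot)$ is the Euler Gamma function. In any product factorization of random variables, the factors are assumed independent. *)

theory Defs
  imports "HOL-Probability.Probability"
begin

definition alpha_cauchy_density :: "real \<Rightarrow> real \<Rightarrow> real" where
  "alpha_cauchy_density \<alpha> x = sin (pi / \<alpha>) / (2 * pi / \<alpha>) * (1 / (1 + \<bar>x\<bar> powr \<alpha>))"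

(* The library's erlang_density only covers integer shape parameters. *)
definition gamma_density :: "real \<Rightarrow> real \<Rightarrow> real" where
  "gamma_density c x = 1 / Gamma c * x powr (c - 1) * exp (- x) * indicator {0<..} x"

end

theory Submission
  imports Defs "HOL-Complex_Analysis.Complex_Analysis" "HOL-Real_Asymp.Real_Asymp"
begin

text \<open>
  Put \<open>\<beta> = \<alpha> / 2\<close> and \<open>T = exp V\<close>. Given \<open>T = t\<close>, the variable \<open>Z * sqrt (t / G) / sqrt 2\<close> is a Cauchy
  variable with density \<open>sqrt t / (pi * (t + x\<^sup>2))\<close>, so the law of the product is a Stieltjes transform of the law
  of \<open>T\<close> evaluated at \<open>x\<^sup>2\<close>. It is therefore enough to write \<open>1 / (1 + y powr \<beta>)\<close> as a Stieltjes
  transform of a positive function, which for \<open>\<beta> < 1\<close> is the residue theorem for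
  \<open>exp z / ((1 + exp (\<beta> * z)) * (exp z - y))\<close> on long rectangles \<open>\<bar>Im z\<bar> \<le> pi\<close>; for
  \<open>\<beta> = 1\<close> the variable \<open>T\<close> is constant. Integrating this identity against powers of \<open>y\<close> and
  using \<open>\<integral> y powr (r - 1) / (1 + y) dy = Gamma r * Gamma (1 - r)\<close> on both sides gives the moments of \<open>T\<close>;
  the moment of order 0 shows that the law of \<open>T\<close> has mass 1. Everything is carried out in the logarithmic variables
  \<open>v = ln t\<close>, \<open>w = ln y\<close>.
\<close>

section \<open>The Stieltjes representation by residues\<close>

lemma contour_integral_linepath_shift:
  "contour_integral (linepath (a + c) (b + c)) f = contour_integral (linepath a b) (\<lambda>z. f (z + c))"
  by (simp add: contour_integral_integral linepath_def algebra_simps)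

lemma contour_integral_horizontal:
  assumes "a < b"
  shows "contour_integral (linepath (Complex a y) (Complex b y)) f = integral {a..b} (\<lambda>x. f (Complex x y))"
proof -
  have "contour_integral (linepath (Complex a y) (Complex b y)) f
      = contour_integral (linepath (of_real a + \<i> * of_real y) (of_real b + \<i> * of_real y)) f"
    by (simp add: Complex_eq)
  also have "\<dots> = contour_integral (linepath (of_real a) (of_real b)) (\<lambda>z. f (z + \<i> * of_real y))"
    by (rule contour_integral_linepath_shift)
  also have "\<dots> = integral {a..b} (\<lambda>x. f (Complex x y))"
    using assms by (subst contour_integral_linepath_Reals_eq) (auto simp: Complex_eq)
  finally show ?thesis .
qed

text \<open>The zeros of \<open>1 + exp (\<beta> * z)\<close> have imaginary part an odd multiple of
  \<open>pi / \<beta>\<close>, which exceeds \<open>pi\<close> in absolute value because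
  \<open>\<beta> < 1\<close>; those of \<open>exp z - exp w\<close> are the points
  \<open>w + 2 * n * pi * \<i>\<close>. So the rectangle encloses a single simple pole, at
  \<open>w\<close>, and no pole lies on its boundary. The second claim supplies continuity and
  integrability of \<open>F\<close> when the four sides are treated separately.\<close>

lemma contour_integral_rectpath_log_kernel:
  fixes \<beta> w R :: real
  assumes "0 < \<beta>" "\<beta> < 1" "\<bar>w\<bar> < R"
  defines "F \<equiv> \<lambda>z. (exp z / (1 + exp (of_real \<beta> * z))) / (exp z - exp (of_real w)) :: complex"
  shows "contour_integral (rectpath (Complex (-R) (-pi)) (Complex R pi)) F
           = 2 * pi * \<i> / (1 + exp (\<beta> * w))"
    and "F holomorphic_on {z. \<bar>Im z\<bar> < min (2*pi) (pi / \<beta>)} - {of_real w}"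
proof -
  \<comment> \<open>The half-width of this strip is greater than \<open>pi\<close>, so the open set
    \<open>S\<close> contains the closed rectangle, while \<open>w\<close> is the only singularity
    in it.\<close>
  define S where "S = {z::complex. \<bar>Im z\<bar> < min (2*pi) (pi / \<beta>)}"
  have S_eq: "S = {z. Im z < min (2*pi) (pi / \<beta>)} \<inter> {z. Im z > - min (2*pi) (pi / \<beta>)}"
    by (auto simp: S_def)
  have "open S"
    unfolding S_eq by (intro open_Int open_halfspace_Im_lt open_halfspace_Im_gt)
  have "convex S"
    unfolding S_eq by (intro convex_Int convex_halfspace_Im_lt convex_halfspace_Im_gt)
  have pib: "pi < pi / \<beta>" using assms by (simp add: field_simps)
  have nz1: "1 + exp (of_real \<beta> * z) \<noteq> 0" if "z \<in> S" for z :: complex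
  proof
    assume "1 + exp (of_real \<beta> * z) = 0"
    hence "exp (of_real \<beta> * z) = exp (\<i> * pi)" by (simp add: add_eq_0_iff)
    then obtain n :: int where "of_real \<beta> * z = \<i> * pi + (of_int (2 * n) * pi) * \<i>"
      unfolding exp_eq by blast
    hence "\<beta> * Im z = pi + 2 * n * pi" by (auto simp: complex_eq_iff)
    hence "\<beta> * Im z = pi * (2 * n + 1)" by (simp add: algebra_simps)
    hence "\<bar>\<beta> * Im z\<bar> = pi * \<bar>2 * n + 1\<bar>" by (simp add: abs_mult)
    moreover have "\<bar>2 * n + 1\<bar> \<ge> 1" by presburger
    ultimately have "\<bar>\<beta> * Im z\<bar> \<ge> pi * 1"
      by (metis mult_left_mono of_int_1_le_iff pi_ge_zero)
    moreover have "\<bar>Im z\<bar> < pi / \<beta>" using that by (simp add: S_def)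
    ultimately show False using assms by (simp add: abs_mult field_simps)
  qed
  have nz2: "exp z - exp (of_real w) \<noteq> 0" if "z \<in> S" "z \<noteq> of_real w" for z :: complex
  proof
    assume "exp z - exp (of_real w) = 0"
    hence "exp z = exp (complex_of_real w)" by simp
    then obtain n :: int where n: "z = of_real w + (of_int (2 * n) * pi) * \<i>"
      unfolding exp_eq by blast
    hence "Im z = 2 * n * pi" by simp
    moreover have "n \<noteq> 0" using n that by auto
    hence "\<bar>n\<bar> \<ge> 1" by presburger
    ultimately have "\<bar>Im z\<bar> \<ge> 2 * pi" by (simp add: abs_mult)
    thus False using that by (simp add: S_def)
  qed
  have holo: "F holomorphic_on S - {of_real w}"
    unfolding F_def using nz1 nz2 by (intro holomorphic_intros) auto
  show "F holomorphic_on {z. \<bar>Im z\<bar> < min (2*pi) (pi / \<beta>)} - {of_real w}"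
    using holo by (simp add: S_def)
  have wS: "complex_of_real w \<in> S" using assms by (simp add: S_def)
  \<comment> \<open>The derivative of \<open>exp z - exp w\<close> at the pole is
    \<open>exp w\<close>, which cancels the numerator.\<close>
  have res: "residue F (of_real w) = 1 / (1 + exp (of_real \<beta> * of_real w))"
  proof -
    have "residue (\<lambda>z. (exp z / (1 + exp (of_real \<beta> * z))) / (exp z - exp (of_real w))) (complex_of_real w)
        = (exp (of_real w) / (1 + exp (of_real \<beta> * of_real w))) / exp (of_real w)"
      using nz1[OF wS]
      by (rule_tac residue_simple_pole_deriv[where s = S])
         (use nz1 wS \<open>open S\<close> \<open>convex S\<close> in
           \<open>auto intro!: holomorphic_intros convex_connected derivative_eq_intros\<close>)
    thus ?thesis by (simp add: F_def)
  qed
  let ?\<gamma> = "rectpath (Complex (-R) (-pi)) (Complex R pi)"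
  have "cbox (Complex (-R) (-pi)) (Complex R pi) \<subseteq> S"
    using pib pi_gt_zero by (auto simp: S_def in_cbox_complex_iff simp del: pi_gt_zero)
  moreover have "path_image ?\<gamma> = cbox (Complex (-R) (-pi)) (Complex R pi) - box (Complex (-R) (-pi)) (Complex R pi)"
    using assms by (intro path_image_rectpath_cbox_minus_box) auto
  moreover have box: "complex_of_real w \<in> box (Complex (-R) (-pi)) (Complex R pi)"
    using assms by (auto simp: in_box_complex_iff)
  ultimately have pim: "path_image ?\<gamma> \<subseteq> S - {of_real w}" by auto
  have "contour_integral ?\<gamma> F = 2 * pi * \<i> * (\<Sum>p\<in>{of_real w}. winding_number ?\<gamma> p * residue F p)"
  proof (rule Residue_theorem[where S = S])
    show "\<forall>z. z \<notin> S \<longrightarrow> winding_number ?\<gamma> z = 0"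
      using winding_number_zero_outside[of ?\<gamma> S] \<open>convex S\<close> pim by auto
  qed (use \<open>open S\<close> \<open>convex S\<close> holo pim in \<open>auto intro: convex_connected\<close>)
  moreover have "winding_number ?\<gamma> (of_real w) = 1"
    using box by (rule winding_number_rectpath)
  ultimately show "contour_integral ?\<gamma> F = 2 * pi * \<i> / (1 + exp (\<beta> * w))"
    by (simp add: res exp_of_real flip: of_real_mult)
qed

text \<open>With \<open>t = exp v\<close> and \<open>y = exp w\<close> the left side is the integral
  of \<open>1 / (t + y)\<close> against \<open>sin (pi * \<beta>) / pi * t powr \<beta> / (1 + 2 * t
  powr \<beta> * cos (pi * \<beta>) + t powr (2 * \<beta>))\<close> over positive \<open>t\<close>.
  The integrand is the jump of \<open>F\<close> between the two horizontal sides, divided by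
  \<open>2 * pi * \<i>\<close>; the vertical sides contribute nothing in the limit, and only the
  residue remains.\<close>

lemma nn_integral_stieltjes_log:
  fixes \<beta> w :: real
  assumes "0 < \<beta>" "\<beta> < 1"
  shows "(\<integral>\<^sup>+ v. ennreal (exp v / (exp v + exp w) *
             (sin (pi * \<beta>) / pi * exp (\<beta> * v) / (1 + 2 * exp (\<beta> * v) * cos (pi * \<beta>) + exp (\<beta> * v) ^ 2))) \<partial>lborel)
         = ennreal (1 / (1 + exp (\<beta> * w)))"
proof -
  define F where "F \<equiv> \<lambda>z. (exp z / (1 + exp (of_real \<beta> * z))) / (exp z - exp (of_real w)) :: complex"
  define S where "S = {z. \<bar>Im z\<bar> < min (2*pi) (pi / \<beta>)} - {complex_of_real w}"
  define D where "D = (\<lambda>v::real. 1 + 2 * exp (\<beta> * v) * cos (pi * \<beta>) + exp (\<beta> * v) ^ 2)"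
  define h where "h = (\<lambda>v. exp v / (exp v + exp w) * (sin (pi * \<beta>) / pi * exp (\<beta> * v) / D v))"
  have pib: "pi < pi / \<beta>" using assms by (simp add: field_simps)
  have sin_pos: "sin (pi * \<beta>) > 0" using assms by (intro sin_gt_zero) auto
  \<comment> \<open>\<open>D v\<close> is the squared modulus of
    \<open>1 + exp (\<beta> * v) * cis (pi * \<beta>)\<close>. It cannot vanish, since the imaginary
    part is positive.\<close>
  have D_eq: "D v = (1 + exp (\<beta> * v) * cos (pi * \<beta>))\<^sup>2 + (exp (\<beta> * v) * sin (pi * \<beta>))\<^sup>2" for v
    using sin_cos_squared_add[of "pi * \<beta>"] unfolding D_def by algebra
  have D_pos: "D v > 0" for v
    unfolding D_eq using sin_pos by (intro add_nonneg_pos) auto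
  have h_nonneg: "h v \<ge> 0" for v
    unfolding h_def using sin_pos D_pos[of v]
    by (intro mult_nonneg_nonneg divide_nonneg_pos add_pos_pos order.strict_implies_order[OF sin_pos]) auto
  have h_cont: "continuous_on A h" for A
  proof -
    have "exp v + exp w \<noteq> 0" "D v \<noteq> 0" for v
      using D_pos[of v] exp_gt_zero[of v] exp_gt_zero[of w] by linarith+
    moreover have "continuous_on A D"
      unfolding D_def by (intro continuous_intros)
    ultimately show ?thesis
      unfolding h_def by (intro continuous_intros) auto
  qed
  \<comment> \<open>On the line \<open>Im z = pi\<close> one has \<open>exp z = - exp v\<close>.
    This turns the difference \<open>exp z - exp w\<close> into minus a sum, and the two signs
    cancel in the quotient.\<close>
  have F_top: "F (Complex v pi) = of_real (exp v / (exp v + exp w)) / (1 + of_real (exp (\<beta> * v)) * cis (pi * \<beta>))" for v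
  proof -
    have "exp (Complex v pi) = - of_real (exp v)"
      by (simp add: exp_eq_polar)
    moreover have "exp (of_real \<beta> * Complex v pi) = of_real (exp (\<beta> * v)) * cis (pi * \<beta>)"
      by (simp add: exp_eq_polar[of "of_real \<beta> * Complex v pi"] mult.commute)
    moreover have "- of_real (exp v) / q / (- of_real (exp v) - exp (of_real w)) = of_real (exp v / (exp v + exp w)) / q" for q :: complex
    proof -
      have "- of_real (exp v) - exp (of_real w) = - complex_of_real (exp v + exp w)"
        by (simp add: exp_of_real)
      moreover have "- a / q / - b = a / b / q" for a b :: complex by (simp add: mult.commute)
      ultimately show ?thesis by (simp only: of_real_divide)
    qed
    ultimately show ?thesis by (simp only: F_def)
  qed
  \<comment> \<open>\<open>\<beta>\<close> and \<open>w\<close> are real, so \<open>F\<close>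
    commutes with conjugation; hence the jump across the strip is purely imaginary.\<close>
  have F_bot: "F (Complex v (-pi)) = cnj (F (Complex v pi))" for v
  proof -
    have "Complex v (-pi) = cnj (Complex v pi)" by (simp add: complex_eq_iff)
    thus ?thesis by (simp add: F_def exp_cnj flip: exp_of_real)
  qed
  have F_diff: "F (Complex v (-pi)) - F (Complex v pi) = of_real (2 * pi * h v) * \<i>" for v
  proof -
    have "Im (of_real a / q) = - a * Im q / ((Re q)\<^sup>2 + (Im q)\<^sup>2)" for a q
      by (simp add: Im_divide)
    from this[of "exp v / (exp v + exp w)" "1 + of_real (exp (\<beta> * v)) * cis (pi * \<beta>)", folded F_top]
    have "Im (F (Complex v pi)) = - pi * h v"
      by (simp add: h_def D_eq mult_ac)
    thus ?thesis by (simp add: F_bot complex_eq_iff)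
  qed
  have holo: "F holomorphic_on S"
    unfolding F_def S_def using assms by (intro contour_integral_rectpath_log_kernel(2)[where R = "\<bar>w\<bar> + 1"]) auto
  have S_I: "z \<in> S" if "\<bar>Im z\<bar> \<le> pi" "z \<noteq> of_real w" for z
    using that pib pi_gt_zero unfolding S_def by (simp del: pi_gt_zero)
  define VR where "VR = (\<lambda>R. contour_integral (linepath (Complex R (-pi)) (Complex R pi)) F)"
  \<comment> \<open>The boundary is traversed counterclockwise: the bottom and right sides count
    positively, the top and left sides negatively. Bottom minus top gives the integral of
    \<open>h\<close>.\<close>
  have key: "of_real (2 * pi * integral {-R..R} h) * \<i> + VR R - VR (-R) = 2 * pi * \<i> / (1 + exp (\<beta> * w))"
    if R: "R > \<bar>w\<bar>" for R
  proof -
    have cont: "continuous_on S F" using holo by (rule holomorphic_on_imp_continuous_on)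
    have sub: "closed_segment (Complex (-R) pi) (Complex R pi) \<subseteq> S"
        "closed_segment (Complex (-R) (-pi)) (Complex R (-pi)) \<subseteq> S"
        "closed_segment (Complex R (-pi)) (Complex R pi) \<subseteq> S"
        "closed_segment (Complex (-R) (-pi)) (Complex (-R) pi) \<subseteq> S"
      using R by (auto intro!: S_I simp: closed_segment_same_Im closed_segment_same_Re closed_segment_eq_real_ivl)
    have integ: "F contour_integrable_on linepath a b" if "closed_segment a b \<subseteq> S" for a b
      using continuous_on_subset[OF cont that] by (rule contour_integrable_continuous_linepath)
    have rev: "contour_integral (linepath b a) F = - contour_integral (linepath a b) F"
      if "closed_segment a b \<subseteq> S" for a b
      using contour_integral_reverse_linepath[OF continuous_on_subset[OF cont that]] by simp
    have "2 * pi * \<i> / (1 + exp (\<beta> * w)) = contour_integral (rectpath (Complex (-R) (-pi)) (Complex R pi)) F"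
      unfolding F_def using assms R by (simp only: contour_integral_rectpath_log_kernel(1))
    also have "\<dots> = contour_integral (linepath (Complex (-R) (-pi)) (Complex R (-pi))) F
        + (VR R - contour_integral (linepath (Complex (-R) pi) (Complex R pi)) F - VR (-R))"
      unfolding rectpath_def Let_def complex.sel VR_def
      using integ[OF sub(2)] integ[OF sub(3)] integ[of "Complex R pi" "Complex (-R) pi"]
        integ[of "Complex (-R) pi" "Complex (-R) (-pi)"] sub(1,4)
      by (simp add: contour_integrable_joinI rev[OF sub(1)] rev[OF sub(4)] closed_segment_commute)
    also have "\<dots> = integral {-R..R} (\<lambda>x. F (Complex x (-pi))) - integral {-R..R} (\<lambda>x. F (Complex x pi)) + VR R - VR (-R)"
      using R by (subst (1 2) contour_integral_horizontal) auto
    also have "integral {-R..R} (\<lambda>x. F (Complex x (-pi))) - integral {-R..R} (\<lambda>x. F (Complex x pi))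
        = integral {-R..R} (\<lambda>x. of_real (2 * pi * h x) * \<i>)"
    proof -
      have "(\<lambda>x. F (Complex x y)) integrable_on {-R..R}" if "y \<in> {pi, -pi}" for y
      proof (rule integrable_continuous_real, rule continuous_on_compose2[OF cont])
        show "continuous_on {-R..R} (\<lambda>x. Complex x y)" by (intro continuous_intros)
        show "(\<lambda>x. Complex x y) ` {-R..R} \<subseteq> S" using that by (auto intro!: S_I simp: complex_eq_iff)
      qed
      thus ?thesis by (subst Henstock_Kurzweil_Integration.integral_diff[symmetric]) (auto simp: F_diff)
    qed
    also have "\<dots> = of_real (2 * pi * integral {-R..R} h) * \<i>"
    proof -
      have "(h has_integral integral {-R..R} h) {-R..R}"
        by (intro integrable_integral integrable_continuous_real h_cont)
      hence "((\<lambda>x. of_real (2 * pi * h x) * \<i>) has_integral of_real (2 * pi * integral {-R..R} h) * \<i>) {-R..R}"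
        by (intro has_integral_mult_left has_integral_of_real has_integral_mult_right)
      thus ?thesis by (rule integral_unique)
    qed
    finally show ?thesis by simp
  qed
  \<comment> \<open>On a vertical line the moduli of \<open>exp z\<close> and
    \<open>exp (\<beta> * z)\<close> are constant, so the reverse triangle inequality bounds both
    factors of the denominator from below. The condition on \<open>x\<close> excludes
    \<open>x = 0\<close> and \<open>x = w\<close>, where these bounds would be zero;
    \<open>2 * pi\<close> is the length of the side.\<close>
  have VR_bound: "norm (VR x) \<le> exp x / (\<bar>exp (\<beta> * x) - 1\<bar> * \<bar>exp x - exp w\<bar>) * (2 * pi)" if "\<bar>x\<bar> > \<bar>w\<bar>" for x
  proof -
    let ?B = "exp x / (\<bar>exp (\<beta> * x) - 1\<bar> * \<bar>exp x - exp w\<bar>)"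
    have sub: "closed_segment (Complex x (-pi)) (Complex x pi) \<subseteq> S"
      using that by (auto intro!: S_I simp: closed_segment_same_Re closed_segment_eq_real_ivl)
    have "norm (VR x) \<le> ?B * norm (Complex x pi - Complex x (-pi))"
      unfolding VR_def
    proof (rule contour_integral_bound_linepath)
      show "F contour_integrable_on linepath (Complex x (-pi)) (Complex x pi)"
        using holo sub by (intro contour_integrable_continuous_linepath holomorphic_on_imp_continuous_on)
           (auto intro: holomorphic_on_subset)
      fix z assume "z \<in> closed_segment (Complex x (-pi)) (Complex x pi)"
      hence z: "Re z = x" by (auto simp: closed_segment_same_Re)
      have "norm (1 + exp (of_real \<beta> * z)) \<ge> \<bar>exp (\<beta> * x) - 1\<bar>"
        using norm_triangle_ineq3[of "exp (of_real \<beta> * z)" "-1"] z by (simp add: norm_exp_eq_Re add.commute)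
      moreover have "norm (exp z - exp (of_real w)) \<ge> \<bar>exp x - exp w\<bar>"
        using norm_triangle_ineq3[of "exp z" "exp (of_real w)"] z by (simp add: norm_exp_eq_Re)
      moreover have "x \<noteq> 0" "x \<noteq> w" using that by auto
      ultimately have "exp x / (norm (1 + exp (of_real \<beta> * z)) * norm (exp z - exp (of_real w))) \<le> ?B"
        using assms by (intro divide_left_mono mult_mono mult_pos_pos) auto
      thus "norm (F z) \<le> ?B" by (simp add: F_def norm_divide norm_mult norm_exp_eq_Re z)
    qed auto
    also have "norm (Complex x pi - Complex x (-pi)) = 2 * pi"
      by (simp add: cmod_def real_sqrt_mult)
    finally show ?thesis .
  qed
  \<comment> \<open>At the right end the bound decays like \<open>exp (- \<beta> * x)\<close>; at
    the left end both denominator factors tend to positive constants and the numerator tends to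
    zero.\<close>
  have VR1: "(VR \<longlongrightarrow> 0) at_top"
  proof (rule Lim_null_comparison)
    show "\<forall>\<^sub>F x in at_top. norm (VR x) \<le> exp x / (\<bar>exp (\<beta> * x) - 1\<bar> * \<bar>exp x - exp w\<bar>) * (2 * pi)"
      using eventually_gt_at_top[of "\<bar>w\<bar>"] by eventually_elim (intro VR_bound, auto)
    show "((\<lambda>x. exp x / (\<bar>exp (\<beta> * x) - 1\<bar> * \<bar>exp x - exp w\<bar>) * (2 * pi)) \<longlongrightarrow> 0) at_top"
      using assms by real_asymp
  qed
  have VR2: "((\<lambda>R. VR (-R)) \<longlongrightarrow> 0) at_top"
  proof (rule Lim_null_comparison)
    show "\<forall>\<^sub>F x in at_top. norm (VR (-x)) \<le> exp (-x) / (\<bar>exp (\<beta> * (-x)) - 1\<bar> * \<bar>exp (-x) - exp w\<bar>) * (2 * pi)"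
      using eventually_gt_at_top[of "\<bar>w\<bar>"] by eventually_elim (intro VR_bound, auto)
    show "((\<lambda>x. exp (-x) / (\<bar>exp (\<beta> * (-x)) - 1\<bar> * \<bar>exp (-x) - exp w\<bar>) * (2 * pi)) \<longlongrightarrow> 0) at_top"
      using assms by real_asymp
  qed
  \<comment> \<open>Solving \<open>key\<close> for the integral of \<open>h\<close> and taking
    imaginary parts transfers the limit from the vertical sides.\<close>
  have "((\<lambda>R. Im (2 * pi * \<i> / (1 + exp (\<beta> * w)) - VR R + VR (-R)) / (2 * pi)) \<longlongrightarrow>
            Im (2 * pi * \<i> / (1 + exp (\<beta> * w)) - 0 + 0) / (2 * pi)) at_top"
    by (intro tendsto_intros VR1 VR2) auto
  also have "?this \<longleftrightarrow> ((\<lambda>R. integral {-R..R} h) \<longlongrightarrow> 1 / (1 + exp (\<beta> * w))) at_top"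
  proof (rule filterlim_cong)
    have "Im (2 * pi * \<i> / (1 + exp (\<beta> * w))) = 2 * pi / (1 + exp (\<beta> * w))"
      by (subst Im_divide_of_real) simp
    thus "nhds (Im (2 * pi * \<i> / (1 + exp (\<beta> * w)) - 0 + 0) / (2 * pi)) = nhds (1 / (1 + exp (\<beta> * w)))"
      by simp
    show "\<forall>\<^sub>F R in at_top. Im (2 * pi * \<i> / (1 + exp (\<beta> * w)) - VR R + VR (-R)) / (2 * pi) = integral {-R..R} h"
      using eventually_gt_at_top[of "\<bar>w\<bar>"]
      by eventually_elim (subst key[symmetric], auto)
  qed simp
  finally have lim: "((\<lambda>R. integral {-R..R} h) \<longlongrightarrow> 1 / (1 + exp (\<beta> * w))) at_top" .
  have [measurable]: "h \<in> borel_measurable borel"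
    by (intro borel_measurable_continuous_onI h_cont)
  \<comment> \<open>The residue argument only gives a limit over symmetric intervals; since
    \<open>h\<close> is nonnegative, monotone convergence identifies it with the integral over the
    whole line.\<close>
  have "(\<lambda>n. \<integral>\<^sup>+ v. ennreal (h v) * indicator {-real n..real n} v \<partial>lborel)
        \<longlonglongrightarrow> (\<integral>\<^sup>+ v. ennreal (h v) \<partial>lborel)"
  proof (rule nn_integral_LIMSEQ)
    show "incseq (\<lambda>n v. ennreal (h v) * indicator {-real n..real n} v)"
      by (auto simp: incseq_def le_fun_def split: split_indicator)
    show "(\<lambda>n. ennreal (h v) * indicator {-real n..real n} v) \<longlonglongrightarrow> ennreal (h v)" for v
    proof (rule tendsto_eventually)
      show "\<forall>\<^sub>F n in sequentially. ennreal (h v) * indicator {-real n..real n} v = ennreal (h v)"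
        using eventually_ge_at_top[of "nat \<lceil>\<bar>v\<bar>\<rceil>"]
        by eventually_elim (auto simp: nat_ceiling_le_eq abs_le_iff indicator_def)
    qed
  qed auto
  moreover have "(\<integral>\<^sup>+ v. ennreal (h v) * indicator {-real n..real n} v \<partial>lborel) = ennreal (integral {-real n..real n} h)" for n
    by (intro nn_integral_has_integral_lebesgue' integrable_integral integrable_continuous_real h_cont h_nonneg)
  moreover have "(\<lambda>n. ennreal (integral {-real n..real n} h)) \<longlonglongrightarrow> ennreal (1 / (1 + exp (\<beta> * w)))"
    by (intro tendsto_ennrealI filterlim_compose[OF lim filterlim_real_sequentially])
  ultimately have "(\<integral>\<^sup>+ v. ennreal (h v) \<partial>lborel) = ennreal (1 / (1 + exp (\<beta> * w)))"
    by (simp add: LIMSEQ_unique)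
  thus ?thesis by (simp only: h_def D_def)
qed

section \<open>Mellin transforms and the moments of the mixing law\<close>

text \<open>The logistic substitution \<open>t = 1 / (1 + exp (- w))\<close> maps the line onto the
  open unit interval and turns the integral into \<open>Beta r (1 - r)\<close>, whose denominator is
  \<open>Gamma 1 = 1\<close>.\<close>

lemma nn_integral_exp_logistic:
  fixes r :: real
  assumes "0 < r" "r < 1"
  shows "(\<integral>\<^sup>+ w. ennreal (exp (r * w) / (1 + exp w)) \<partial>lborel) = ennreal (Gamma r * Gamma (1 - r))"
proof -
  let ?b = "\<lambda>t::real. t powr (r - 1) * (1 - t) powr ((1 - r) - 1)"
  let ?g = "\<lambda>w::real. 1 / (1 + exp (- w))" and ?g' = "\<lambda>w::real. exp (-w) / (1 + exp (- w))\<^sup>2"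
  have pos: "1 + exp w \<noteq> 0" "1 + exp w > 0" for w :: real
    using exp_gt_zero[of w] by linarith+
  have img: "range ?g = {0<..<1}"
  proof (intro equalityI subsetI)
    fix t :: real assume t: "t \<in> {0<..<1}"
    hence "?g (ln (t / (1 - t))) = t"
      by (subst exp_minus, subst exp_ln) (auto simp: field_simps)
    thus "t \<in> range ?g" by (metis rangeI)
  qed (auto simp: field_simps pos intro: add_pos_pos)
  have "(?b has_integral Beta r (1 - r)) {0<..<1}"
    using has_integral_Beta_real[of r "1 - r"] assms by (simp add: has_integral_Icc_iff_Ioo)
  hence "?b absolutely_integrable_on range ?g \<and> integral (range ?g) ?b = Beta r (1 - r)"
    unfolding img by (auto intro!: nonnegative_absolutely_integrable_1 simp: integrable_on_def integral_unique)
  also have "?this \<longleftrightarrow> (\<lambda>w. \<bar>?g' w\<bar> * ?b (?g w)) absolutely_integrable_on UNIV \<and>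
      integral UNIV (\<lambda>w. \<bar>?g' w\<bar> * ?b (?g w)) = Beta r (1 - r)"
    by (rule has_absolute_integral_change_of_variables_1'[symmetric])
       (auto intro!: derivative_eq_intros inj_onI simp: pos power2_eq_square)
  finally have "((\<lambda>w. \<bar>?g' w\<bar> * ?b (?g w)) has_integral Beta r (1 - r)) UNIV"
    by (auto simp: has_integral_iff set_lebesgue_integral_eq_integral(1))
  also have "(\<lambda>w. \<bar>?g' w\<bar> * ?b (?g w)) = (\<lambda>w. exp (r * w) / (1 + exp w))"
  proof
    fix w :: real
    define u where "u = 1 + exp (- w)"
    have u: "u > 0" using pos[of "-w"] by (simp add: u_def)
    have 1: "1 - 1 / u = exp (-w) / u" using u by (simp add: u_def field_simps)
    have "\<bar>?g' w\<bar> * ?b (?g w) = exp (-w) / u\<^sup>2 * ((1 / u) powr (r - 1) * (exp (-w) / u) powr (-r))"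
      using u by (simp add: u_def[symmetric] 1)
    also have "\<dots> = exp (-w) / u\<^sup>2 * (exp (r * w) * (u powr (1 - r) * u powr r))"
      using u by (simp add: powr_divide powr_minus exp_powr_real powr_diff powr_mult field_simps exp_minus)
    also have "u powr (1 - r) * u powr r = u" using u by (simp flip: powr_add)
    also have "exp (-w) / u\<^sup>2 * (exp (r * w) * u) = exp (r * w) / (1 + exp w)"
    proof -
      have "exp (-w) / u = 1 / (1 + exp w)"
        using pos[of w] by (simp add: u_def exp_minus divide_simps)
      moreover have "exp (-w) / u\<^sup>2 * (exp (r * w) * u) = exp (r * w) * (exp (-w) / u)"
        using u by (simp add: power2_eq_square)
      ultimately show ?thesis by simp
    qed
    finally show "\<bar>?g' w\<bar> * ?b (?g w) = exp (r * w) / (1 + exp w)" .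
  qed
  finally have "((\<lambda>w. exp (r * w) / (1 + exp w)) has_integral Gamma r * Gamma (1 - r)) UNIV"
    by (simp add: Beta_def)
  thus ?thesis
    by (intro nn_integral_has_integral_lborel) (auto simp: pos less_imp_le)
qed

text \<open>Both sides of \<open>mix\<close> are multiplied by \<open>exp (r * w)\<close> and
  integrated over \<open>w\<close>. The right side becomes a logistic integral with parameter
  \<open>r / \<beta>\<close>; on the left, Tonelli and a translation split off a logistic integral
  with parameter \<open>r\<close>, which leaves the moment of \<open>N\<close>. Only
  sigma-finiteness of \<open>N\<close> is assumed, because its total mass is itself obtained from
  this formula, at \<open>r = 1/2\<close>.\<close>

lemma mellin_of_stieltjes_log:
  fixes \<beta> r C :: real
  assumes "sigma_finite_measure N" and sets [measurable_cong]: "sets N = sets borel"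
    and mix: "\<And>w. (\<integral>\<^sup>+ v. ennreal (exp (v / 2) / (exp v + exp w)) \<partial>N) = ennreal (C / (1 + exp (\<beta> * w)))"
    and "C > 0" "0 < r" "r < \<beta>" "\<beta> \<le> 1"
  shows "(\<integral>\<^sup>+ v. ennreal (exp ((r - 1/2) * v)) \<partial>N)
         = ennreal (C / \<beta> * (Gamma (r / \<beta>) * Gamma (1 - r / \<beta>)) / (Gamma r * Gamma (1 - r)))"
proof -
  interpret sigma_finite_measure N by fact
  interpret pair_sigma_finite lborel N ..
  have \<beta>: "\<beta> > 0" and r1: "r < 1" using assms by auto
  have G: "Gamma r * Gamma (1 - r) > 0" using assms by (intro mult_pos_pos Gamma_real_pos) auto
  have "ennreal (C / \<beta> * (Gamma (r / \<beta>) * Gamma (1 - r / \<beta>)))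
      = ennreal (C / \<beta>) * (\<integral>\<^sup>+ w. ennreal (exp (r / \<beta> * w) / (1 + exp w)) \<partial>lborel)"
    using assms \<beta> by (subst nn_integral_exp_logistic) (auto simp: ennreal_mult'[symmetric])
  \<comment> \<open>The rescaling of \<open>w\<close> by \<open>1 / \<beta>\<close>, written in the
    shape of the affine substitution rule.\<close>
  also have "\<dots> = ennreal \<bar>1 / \<beta>\<bar> * (\<integral>\<^sup>+ w. ennreal (C * exp (r * (0 + 1 / \<beta> * w)) / (1 + exp (\<beta> * (0 + 1 / \<beta> * w)))) \<partial>lborel)"
    using \<beta> \<open>C > 0\<close> 
    by (subst (1 2) nn_integral_cmult[symmetric]) (auto simp: ennreal_mult'[symmetric] field_simps add_pos_pos intro!: nn_integral_cong arg_cong[where f = ennreal])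
  also have "\<dots> = (\<integral>\<^sup>+ w. ennreal (C * exp (r * w) / (1 + exp (\<beta> * w))) \<partial>lborel)"
    using \<beta> by (intro nn_integral_real_affine[symmetric]) auto
  also have "\<dots> = (\<integral>\<^sup>+ w. \<integral>\<^sup>+ v. ennreal (exp (r * w) * (exp (v / 2) / (exp v + exp w))) \<partial>N \<partial>lborel)"
  proof (rule nn_integral_cong)
    fix w :: real
    have "(\<integral>\<^sup>+ v. ennreal (exp (r * w) * (exp (v / 2) / (exp v + exp w))) \<partial>N)
        = ennreal (exp (r * w)) * (\<integral>\<^sup>+ v. ennreal (exp (v / 2) / (exp v + exp w)) \<partial>N)"
      unfolding ennreal_mult'[OF exp_ge_zero] by (rule nn_integral_cmult) measurable
    also have "\<dots> = ennreal (C * exp (r * w) / (1 + exp (\<beta> * w)))"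
      unfolding mix by (subst ennreal_mult'[symmetric]) (auto simp: mult_ac)
    finally show "ennreal (C * exp (r * w) / (1 + exp (\<beta> * w)))
        = (\<integral>\<^sup>+ v. ennreal (exp (r * w) * (exp (v / 2) / (exp v + exp w))) \<partial>N)" ..
  qed
  also have "\<dots> = (\<integral>\<^sup>+ v. \<integral>\<^sup>+ w. ennreal (exp (r * w) * (exp (v / 2) / (exp v + exp w))) \<partial>lborel \<partial>N)"
    by (rule Fubini'[symmetric]) measurable
  also have "\<dots> = (\<integral>\<^sup>+ v. ennreal (exp ((r - 1/2) * v)) * ennreal (Gamma r * Gamma (1 - r)) \<partial>N)"
  proof (rule nn_integral_cong)
    fix v :: real
    \<comment> \<open>Translating \<open>w\<close> by \<open>v\<close> separates the variables: the
      exponent \<open>r - 1/2\<close> collects \<open>r\<close> from the weight, \<open>1/2\<close>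
      from the numerator and \<open>-1\<close> from the denominator of the kernel.\<close>
    have "(\<integral>\<^sup>+ w. ennreal (exp (r * w) * (exp (v / 2) / (exp v + exp w))) \<partial>lborel)
        = ennreal \<bar>1\<bar> * (\<integral>\<^sup>+ w. ennreal (exp (r * (v + 1 * w)) * (exp (v / 2) / (exp v + exp (v + 1 * w)))) \<partial>lborel)"
      by (rule nn_integral_real_affine) auto
    also have "\<dots> = (\<integral>\<^sup>+ w. ennreal (exp ((r - 1/2) * v)) * ennreal (exp (r * w) / (1 + exp w)) \<partial>lborel)"
    proof -
      have "exp (r * (v + w)) * (exp (v / 2) / (exp v + exp (v + w))) = exp ((r - 1/2) * v) * (exp (r * w) / (1 + exp w))" for w
      proof -
        have "exp (v / 2) / (exp v + exp (v + w)) = exp (- v / 2) / (1 + exp w)"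
        proof -
          have "exp v + exp (v + w) = exp (v / 2) * (exp (v / 2) * (1 + exp w))"
            by (simp add: distrib_left flip: exp_add)
          moreover have "exp (- v / 2) = 1 / exp (v / 2)"
            using exp_minus[of "v / 2"] by (simp add: inverse_eq_divide)
          ultimately show ?thesis by (simp only:) simp
        qed
        moreover have "exp (r * (v + w)) * exp (- v / 2) = exp ((r - 1/2) * v) * exp (r * w)"
          by (simp add: algebra_simps flip: exp_add)
        ultimately show ?thesis by (simp add: field_simps)
      qed
      thus ?thesis by (simp add: ennreal_mult'[symmetric])
    qed
    also have "\<dots> = ennreal (exp ((r - 1/2) * v)) * ennreal (Gamma r * Gamma (1 - r))"
      using assms r1 by (subst nn_integral_cmult) (auto simp: nn_integral_exp_logistic)
    finally show "(\<integral>\<^sup>+ w. ennreal (exp (r * w) * (exp (v / 2) / (exp v + exp w))) \<partial>lborel)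
        = ennreal (exp ((r - 1/2) * v)) * ennreal (Gamma r * Gamma (1 - r))" .
  qed
  also have "\<dots> = (\<integral>\<^sup>+ v. ennreal (exp ((r - 1/2) * v)) \<partial>N) * ennreal (Gamma r * Gamma (1 - r))"
    by (rule nn_integral_multc) auto
  finally have eq: "ennreal (C / \<beta> * (Gamma (r / \<beta>) * Gamma (1 - r / \<beta>)))
      = (\<integral>\<^sup>+ v. ennreal (exp ((r - 1/2) * v)) \<partial>N) * ennreal (Gamma r * Gamma (1 - r))" .
  \<comment> \<open>The moment is not yet known to be finite, so the division is carried out as
    multiplication by the reciprocal of a positive real.\<close>
  have "(\<integral>\<^sup>+ v. ennreal (exp ((r - 1/2) * v)) \<partial>N)
      = (\<integral>\<^sup>+ v. ennreal (exp ((r - 1/2) * v)) \<partial>N) * ennreal ((Gamma r * Gamma (1 - r)) * (1 / (Gamma r * Gamma (1 - r))))"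
    using right_inverse[OF less_imp_neq[OF G, symmetric]] by (simp only: inverse_eq_divide ennreal_1 mult_1_right)
  also have "\<dots> = ennreal (C / \<beta> * (Gamma (r / \<beta>) * Gamma (1 - r / \<beta>))) * ennreal (1 / (Gamma r * Gamma (1 - r)))"
    unfolding eq by (subst ennreal_mult'[OF less_imp_le[OF G]]) (simp only: mult.assoc)
  also have "\<dots> = ennreal (C / \<beta> * (Gamma (r / \<beta>) * Gamma (1 - r / \<beta>)) * (1 / (Gamma r * Gamma (1 - r))))"
    using G by (intro ennreal_mult''[symmetric]) simp
  finally show ?thesis by simp
qed

section \<open>The Cauchy law as a Gaussian over the root of a Gamma variable\<close>

lemma nn_integral_exp_neg:
  fixes l :: real
  assumes "l > 0"
  shows "(\<integral>\<^sup>+ g. ennreal (exp (- g * l)) * indicator {0<..} g \<partial>lborel) = ennreal (1 / l)"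
proof -
  have "ennreal l * (\<integral>\<^sup>+ g. ennreal (exp (- g * l)) * indicator {0<..} g \<partial>lborel)
      = (\<integral>\<^sup>+ g. ennreal l * (ennreal (exp (- g * l)) * indicator {0<..} g) \<partial>lborel)"
    by (rule nn_integral_cmult[symmetric]) auto
  also have "\<dots> = (\<integral>\<^sup>+ g. ennreal (exponential_density l g) \<partial>lborel)"
    using assms by (intro nn_integral_cong_AE AE_I[of _ _ "{0}"])
      (auto simp: exponential_density_def indicator_def ennreal_mult'[symmetric])
  also have "\<dots> = 1"
    using prob_space.emeasure_space_1[OF prob_space_exponential_density[OF assms]]
    by (simp add: emeasure_density)
  finally have "ennreal (1 / l) * (ennreal l * (\<integral>\<^sup>+ g. ennreal (exp (- g * l)) * indicator {0<..} g \<partial>lborel)) = ennreal (1 / l)"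
    by simp
  thus ?thesis using assms by (simp add: mult.assoc[symmetric] ennreal_mult'[symmetric])
qed

lemma gamma_density_measurable [measurable]: "gamma_density c \<in> borel_measurable borel"
  unfolding gamma_density_def[abs_def] by measurable

lemma prob_space_gamma_density:
  assumes "c > 0"
  shows "prob_space (density lborel (\<lambda>x. ennreal (gamma_density c x)))"
proof (rule prob_spaceI)
  have "(\<integral>\<^sup>+ x. ennreal (gamma_density c x) \<partial>lborel)
      = (\<integral>\<^sup>+ x. ennreal (1 / Gamma c) * ennreal (indicator {0..} x * x powr (c - 1) / exp x) \<partial>lborel)"
    using Gamma_real_pos[OF assms] by (intro nn_integral_cong_AE AE_I[of _ _ "{0}"])
      (auto simp: gamma_density_def indicator_def exp_minus field_simps ennreal_mult'[symmetric])
  also have "\<dots> = ennreal (1 / Gamma c) * ennreal (Gamma c)"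
    by (subst nn_integral_cmult) (auto simp: Gamma_conv_nn_integral_real[OF assms])
  also have "\<dots> = 1"
    using Gamma_real_pos[OF assms] by (simp flip: ennreal_mult')
  finally show "emeasure (density lborel (\<lambda>x. ennreal (gamma_density c x)))
      (space (density lborel (\<lambda>x. ennreal (gamma_density c x)))) = 1"
    by (simp add: emeasure_density)
qed

text \<open>If \<open>G\<close> has the Gamma law of parameter \<open>1/2\<close>, then
  \<open>2 * G\<close> is chi-squared with one degree of freedom, so \<open>Z / sqrt (2 * G)\<close>
  is standard Cauchy; this is where the factor \<open>1 / sqrt 2\<close> comes from. The remaining
  factor \<open>sqrt t\<close> is a scale. Stating the law through an arbitrary
  \<open>\<phi>\<close> allows a later integration over \<open>t\<close>.\<close>

lemma normal_over_sqrt_gamma: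
  fixes t :: real and \<phi> :: "real \<Rightarrow> ennreal"
  assumes [measurable]: "\<phi> \<in> borel_measurable borel" and t: "t > 0"
  shows "(\<integral>\<^sup>+ g. \<integral>\<^sup>+ z. \<phi> (1 / sqrt 2 * (z * sqrt (inverse g * t)))
               \<partial>density lborel (\<lambda>z. ennreal (std_normal_density z))
             \<partial>density lborel (\<lambda>g. ennreal (gamma_density (1/2) g)))
         = (\<integral>\<^sup>+ x. \<phi> x * ennreal (sqrt t / (pi * (t + x\<^sup>2))) \<partial>lborel)"
proof -
  interpret std: prob_space std_normal_distribution
    by (rule prob_space_normal_density) simp
  have m: "(\<lambda>g. \<integral>\<^sup>+ z. \<phi> (1 / sqrt 2 * (z * sqrt (inverse g * t))) \<partial>std_normal_distribution)
      \<in> borel_measurable lborel"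
    by measurable
  have "(\<integral>\<^sup>+ g. \<integral>\<^sup>+ z. \<phi> (1 / sqrt 2 * (z * sqrt (inverse g * t)))
               \<partial>density lborel (\<lambda>z. ennreal (std_normal_density z))
             \<partial>density lborel (\<lambda>g. ennreal (gamma_density (1/2) g)))
      = (\<integral>\<^sup>+ g. \<integral>\<^sup>+ x. \<phi> x * (ennreal (exp (- g * (1 + x\<^sup>2 / t)) / (pi * sqrt t)) * indicator {0<..} g) \<partial>lborel \<partial>lborel)"
  proof (subst nn_integral_density[OF _ m], measurable, intro nn_integral_cong)
    fix g :: real
    show "ennreal (gamma_density (1/2) g) * (\<integral>\<^sup>+ z. \<phi> (1 / sqrt 2 * (z * sqrt (inverse g * t))) \<partial>density lborel (\<lambda>z. ennreal (std_normal_density z)))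
        = (\<integral>\<^sup>+ x. \<phi> x * (ennreal (exp (- g * (1 + x\<^sup>2 / t)) / (pi * sqrt t)) * indicator {0<..} g) \<partial>lborel)"
    proof (cases "g > 0")
      case False
      thus ?thesis by (simp add: gamma_density_def)
    next
      case True
      \<comment> \<open>The standard deviation of the scaled product when \<open>g\<close> and
        \<open>t\<close> are fixed.\<close>
      define a where "a = sqrt (t / (2 * g))"
      have a: "a > 0" "a\<^sup>2 = t / (2 * g)" using True t by (auto simp: a_def)
      have arg: "1 / sqrt 2 * (z * sqrt (inverse g * t)) = 0 + a * z" for z
        using True t by (simp add: a_def real_sqrt_divide real_sqrt_mult real_sqrt_inverse field_simps)
      \<comment> \<open>In the joint density of \<open>g\<close> and \<open>x\<close> the factor
        \<open>1 / sqrt g\<close> of the Gamma density cancels against \<open>1 / a\<close>, so the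
        dependence on \<open>g\<close> is purely exponential.\<close>
      have dens: "gamma_density (1/2) g * (std_normal_density (x / a) / a) = exp (- g * (1 + x\<^sup>2 / t)) / (pi * sqrt t)" for x
      proof -
        have "(x / a)\<^sup>2 / 2 = g * x\<^sup>2 / t" using True t a by (simp add: power_divide field_simps)
        hence n: "std_normal_density (x / a) = 1 / sqrt (2 * pi) * exp (- (g * x\<^sup>2 / t))"
          by (simp add: std_normal_density_def)
        have "gamma_density (1/2) g = 1 / sqrt pi * (1 / sqrt g) * exp (- g)"
        proof -
          have "g powr (1/2 - 1) = 1 / sqrt g"
            using True powr_minus_divide[of g "1/2"] by (simp add: powr_half_sqrt)
          thus ?thesis using True by (simp only: gamma_density_def Gamma_one_half_real) simp
        qed
        hence "gamma_density (1/2) g * (std_normal_density (x / a) / a)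
            = (exp (- g) * exp (- (g * x\<^sup>2 / t))) * (1 / (sqrt pi * sqrt g * sqrt (2 * pi) * a))"
          unfolding n by (simp only: times_divide_eq_left times_divide_eq_right divide_divide_eq_left mult_1_left mult_1_right mult_ac)
        also have "exp (- g) * exp (- (g * x\<^sup>2 / t)) = exp (- g * (1 + x\<^sup>2 / t))"
          by (simp add: algebra_simps flip: exp_add)
        also have "sqrt pi * sqrt g * sqrt (2 * pi) * a = pi * sqrt t"
          using True t by (simp add: a_def real_sqrt_divide real_sqrt_mult)
        finally show ?thesis by simp
      qed
      have "(\<integral>\<^sup>+ z. \<phi> (1 / sqrt 2 * (z * sqrt (inverse g * t))) \<partial>density lborel (\<lambda>z. ennreal (std_normal_density z)))
          = (\<integral>\<^sup>+ z. ennreal (std_normal_density ((0 + a * z) / a)) * \<phi> (0 + a * z) \<partial>lborel)"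
        unfolding arg using a by (subst nn_integral_density) auto
      also have "\<dots> = ennreal (1 / a) * (ennreal \<bar>a\<bar> * (\<integral>\<^sup>+ z. ennreal (std_normal_density ((0 + a * z) / a)) * \<phi> (0 + a * z) \<partial>lborel))"
        using a by (simp add: mult.assoc[symmetric] ennreal_mult'[symmetric])
      also have "\<dots> = ennreal (1 / a) * (\<integral>\<^sup>+ x. ennreal (std_normal_density (x / a)) * \<phi> x \<partial>lborel)"
        using a by (subst nn_integral_real_affine[where c = a and t = 0]) auto
      finally have "ennreal (gamma_density (1/2) g) * (\<integral>\<^sup>+ z. \<phi> (1 / sqrt 2 * (z * sqrt (inverse g * t))) \<partial>density lborel (\<lambda>z. ennreal (std_normal_density z)))
          = (\<integral>\<^sup>+ x. ennreal (gamma_density (1/2) g) * (ennreal (1 / a) * (ennreal (std_normal_density (x / a)) * \<phi> x)) \<partial>lborel)"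
        by (simp add: nn_integral_cmult)
      also have "\<dots> = (\<integral>\<^sup>+ x. \<phi> x * (ennreal (exp (- g * (1 + x\<^sup>2 / t)) / (pi * sqrt t)) * indicator {0<..} g) \<partial>lborel)"
      proof (intro nn_integral_cong)
        fix x :: real
        have "gamma_density (1/2) g \<ge> 0" using True by (simp add: gamma_density_def Gamma_one_half_real)
        hence "ennreal (gamma_density (1/2) g) * (ennreal (1 / a) * (ennreal (std_normal_density (x / a)) * \<phi> x))
            = ennreal (gamma_density (1/2) g * (std_normal_density (x / a) / a)) * \<phi> x"
          using a by (simp add: ennreal_mult'[symmetric] mult.assoc[symmetric])
        thus "ennreal (gamma_density (1/2) g) * (ennreal (1 / a) * (ennreal (std_normal_density (x / a)) * \<phi> x))
            = \<phi> x * (ennreal (exp (- g * (1 + x\<^sup>2 / t)) / (pi * sqrt t)) * indicator {0<..} g)"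
          using True by (simp only: dens) (simp add: mult.commute)
      qed
      finally show ?thesis .
    qed
  qed
  \<comment> \<open>Integrating over \<open>g\<close> first leaves an exponential integral of rate
    \<open>1 + x\<^sup>2 / t\<close>, which produces the Cauchy density.\<close>
  also have "\<dots> = (\<integral>\<^sup>+ x. \<integral>\<^sup>+ g. \<phi> x * (ennreal (exp (- g * (1 + x\<^sup>2 / t)) / (pi * sqrt t)) * indicator {0<..} g) \<partial>lborel \<partial>lborel)"
    by (rule lborel_pair.Fubini') measurable
  also have "\<dots> = (\<integral>\<^sup>+ x. \<phi> x * ennreal (sqrt t / (pi * (t + x\<^sup>2))) \<partial>lborel)"
  proof (intro nn_integral_cong)
    fix x :: real
    have l: "1 + x\<^sup>2 / t > 0" using t by (intro add_pos_nonneg) auto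
    have "(\<integral>\<^sup>+ g. \<phi> x * (ennreal (exp (- g * (1 + x\<^sup>2 / t)) / (pi * sqrt t)) * indicator {0<..} g) \<partial>lborel)
        = (\<integral>\<^sup>+ g. \<phi> x * (ennreal (1 / (pi * sqrt t)) * (ennreal (exp (- g * (1 + x\<^sup>2 / t))) * indicator {0<..} g)) \<partial>lborel)"
      using t by (intro nn_integral_cong) (simp add: mult.assoc[symmetric] ennreal_mult'[symmetric])
    also have "\<dots> = \<phi> x * (ennreal (1 / (pi * sqrt t)) * ennreal (1 / (1 + x\<^sup>2 / t)))"
      using nn_integral_exp_neg[OF l] by (simp add: nn_integral_cmult)
    also have "ennreal (1 / (pi * sqrt t)) * ennreal (1 / (1 + x\<^sup>2 / t)) = ennreal (1 / (pi * sqrt t) * (1 / (1 + x\<^sup>2 / t)))"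
      using t by (intro ennreal_mult'[symmetric]) auto
    also have "1 / (pi * sqrt t) * (1 / (1 + x\<^sup>2 / t)) = sqrt t / (pi * (t + x\<^sup>2))"
    proof -
      have "1 + x\<^sup>2 / t = (t + x\<^sup>2) / t" using t by (simp add: field_simps)
      hence "1 / (pi * sqrt t) * (1 / (1 + x\<^sup>2 / t)) = (t / sqrt t) / (pi * (t + x\<^sup>2))" by simp
      thus ?thesis using t by (simp add: real_div_sqrt)
    qed
    finally show "(\<integral>\<^sup>+ g. \<phi> x * (ennreal (exp (- g * (1 + x\<^sup>2 / t)) / (pi * sqrt t)) * indicator {0<..} g) \<partial>lborel)
        = \<phi> x * ennreal (sqrt t / (pi * (t + x\<^sup>2)))" .
  qed
  finally show ?thesis .
qed

section \<open>The mixing measure and the mixture identity\<close>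

lemma Gamma_reflection_real:
  fixes x :: real
  shows "Gamma x * Gamma (1 - x) = pi / sin (pi * x)"
proof -
  have "complex_of_real (Gamma x * Gamma (1 - x)) = of_real (pi / sin (pi * x))"
    using Gamma_reflection_complex[of "of_real x"] Gamma_complex_of_real[of x] Gamma_complex_of_real[of "1 - x"]
    by (simp flip: sin_of_real)
  thus ?thesis by (simp only: of_real_eq_iff)
qed

text \<open>\<open>N\<close> is the law of \<open>V\<close>, the logarithm of \<open>T\<close>; the
  factor \<open>exp (v / 2)\<close> in the kernel is the \<open>sqrt t\<close> of the Cauchy
  density. For \<open>\<beta> = 1\<close> the function \<open>1 / (1 + y)\<close> is already the
  Stieltjes transform of the unit mass at \<open>t = 1\<close>, that is \<open>v = 0\<close>, which
  forces \<open>C = 1\<close>.\<close>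

lemma exists_log_mixture:
  fixes \<beta> C :: real
  assumes "0 < \<beta>" "\<beta> \<le> 1" "0 < C" and C: "\<beta> = 1 \<Longrightarrow> C = 1"
  obtains N :: "real measure" where "sigma_finite_measure N" "sets N = sets borel"
    "\<And>w. (\<integral>\<^sup>+ v. ennreal (exp (v / 2) / (exp v + exp w)) \<partial>N) = ennreal (C / (1 + exp (\<beta> * w)))"
proof (cases "\<beta> = 1")
  case True
  show ?thesis
  proof (rule that[of "return borel 0"])
    show "sigma_finite_measure (return borel (0::real))"
      by (intro finite_measure.axioms prob_space.finite_measure prob_space_return) auto
    show "(\<integral>\<^sup>+ v. ennreal (exp (v / 2) / (exp v + exp w)) \<partial>return borel 0) = ennreal (C / (1 + exp (\<beta> * w)))" for w
      using C True by (subst nn_integral_return) auto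
  qed simp
next
  case False
  \<comment> \<open>The factor \<open>exp (v / 2)\<close> here and the one in the kernel multiply to
    the \<open>exp v\<close> of the Stieltjes formula.\<close>
  define d where "d = (\<lambda>v. C * exp (v / 2) * (sin (pi * \<beta>) / pi * exp (\<beta> * v) /
      (1 + 2 * exp (\<beta> * v) * cos (pi * \<beta>) + exp (\<beta> * v) ^ 2)))"
  have [measurable]: "d \<in> borel_measurable borel" unfolding d_def by measurable
  have sin_pos: "sin (pi * \<beta>) > 0" using assms False by (intro sin_gt_zero) auto
  have "1 + 2 * E * cos (pi * \<beta>) + E ^ 2 = (E + cos (pi * \<beta>))\<^sup>2 + (sin (pi * \<beta>))\<^sup>2" for E
    using sin_cos_squared_add[of "pi * \<beta>"] by algebra
  hence "1 + 2 * E * cos (pi * \<beta>) + E ^ 2 \<ge> 0" for E by simp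
  hence d_nonneg: "d v \<ge> 0" for v
    using assms less_imp_le[OF sin_pos] unfolding d_def by (intro mult_nonneg_nonneg divide_nonneg_nonneg) auto
  show ?thesis
  proof (rule that[of "density lborel (\<lambda>v. ennreal (d v))"])
    show "sigma_finite_measure (density lborel (\<lambda>v. ennreal (d v)))"
      by (subst sigma_finite_measure.sigma_finite_iff_density_finite[OF lborel.sigma_finite_measure_axioms]) auto
    fix w :: real
    have "(\<integral>\<^sup>+ v. ennreal (exp (v / 2) / (exp v + exp w)) \<partial>density lborel (\<lambda>v. ennreal (d v)))
        = (\<integral>\<^sup>+ v. ennreal (d v) * ennreal (exp (v / 2) / (exp v + exp w)) \<partial>lborel)"
      by (rule nn_integral_density) auto
    also have "\<dots> = (\<integral>\<^sup>+ v. ennreal C * ennreal (exp v / (exp v + exp w) *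
             (sin (pi * \<beta>) / pi * exp (\<beta> * v) / (1 + 2 * exp (\<beta> * v) * cos (pi * \<beta>) + exp (\<beta> * v) ^ 2))) \<partial>lborel)"
    proof (rule nn_integral_cong)
      fix v :: real
      have "exp v = exp (v / 2) * exp (v / 2)" by (simp flip: exp_add)
      hence "d v * (exp (v / 2) / (exp v + exp w)) = C * (exp v / (exp v + exp w) *
             (sin (pi * \<beta>) / pi * exp (\<beta> * v) / (1 + 2 * exp (\<beta> * v) * cos (pi * \<beta>) + exp (\<beta> * v) ^ 2)))"
        unfolding d_def by (simp only: times_divide_eq_left times_divide_eq_right mult_ac)
      thus "ennreal (d v) * ennreal (exp (v / 2) / (exp v + exp w)) = ennreal C * ennreal (exp v / (exp v + exp w) *
             (sin (pi * \<beta>) / pi * exp (\<beta> * v) / (1 + 2 * exp (\<beta> * v) * cos (pi * \<beta>) + exp (\<beta> * v) ^ 2)))"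
        using ennreal_mult'[OF d_nonneg] ennreal_mult'[of C] \<open>C > 0\<close> by (metis less_imp_le)
    qed
    also have "\<dots> = ennreal C * ennreal (1 / (1 + exp (\<beta> * w)))"
      using assms False by (subst nn_integral_cmult, measurable) (subst nn_integral_stieltjes_log, auto)
    also have "\<dots> = ennreal (C / (1 + exp (\<beta> * w)))"
      using \<open>C > 0\<close> by (subst ennreal_mult'[symmetric]) auto
    finally show "(\<integral>\<^sup>+ v. ennreal (exp (v / 2) / (exp v + exp w)) \<partial>density lborel (\<lambda>v. ennreal (d v)))
        = ennreal (C / (1 + exp (\<beta> * w)))" .
  qed simp
qed

text \<open>After exchanging the integrals, the inner one is \<open>mix\<close> at
  \<open>w = ln (x\<^sup>2)\<close>. The constant in \<open>mix\<close> is \<open>pi\<close> times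
  the normalising constant of the \<alpha>-Cauchy density, to absorb the \<open>1 / pi\<close> of
  the Cauchy density.\<close>

lemma alpha_cauchy_mixture:
  fixes \<alpha> :: real and \<phi> :: "real \<Rightarrow> ennreal"
  assumes "sigma_finite_measure N" and sets [measurable_cong]: "sets N = sets borel"
    and mix: "\<And>w. (\<integral>\<^sup>+ v. ennreal (exp (v / 2) / (exp v + exp w)) \<partial>N)
                = ennreal (sin (pi / \<alpha>) * \<alpha> / 2 / (1 + exp (\<alpha> / 2 * w)))"
    and [measurable]: "\<phi> \<in> borel_measurable borel" and "\<alpha> > 0"
  shows "(\<integral>\<^sup>+ v. \<integral>\<^sup>+ x. \<phi> x * ennreal (sqrt (exp v) / (pi * (exp v + x\<^sup>2))) \<partial>lborel \<partial>N)
         = (\<integral>\<^sup>+ x. \<phi> x * ennreal (alpha_cauchy_density \<alpha> x) \<partial>lborel)"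
proof -
  interpret sigma_finite_measure N by fact
  interpret pair_sigma_finite lborel N ..
  have "(\<integral>\<^sup>+ v. \<integral>\<^sup>+ x. \<phi> x * ennreal (sqrt (exp v) / (pi * (exp v + x\<^sup>2))) \<partial>lborel \<partial>N)
      = (\<integral>\<^sup>+ x. \<integral>\<^sup>+ v. \<phi> x * ennreal (sqrt (exp v) / (pi * (exp v + x\<^sup>2))) \<partial>N \<partial>lborel)"
    by (rule Fubini') measurable
  also have "\<dots> = (\<integral>\<^sup>+ x. \<phi> x * ennreal (alpha_cauchy_density \<alpha> x) \<partial>lborel)"
  \<comment> \<open>The logarithm of \<open>x\<^sup>2\<close> makes sense only for nonzero
    \<open>x\<close>, so equality is shown off the null set \<open>{0}\<close>.\<close>
  proof (rule nn_integral_cong_AE, rule AE_I[of _ _ "{0}"], rule subsetI, rule ccontr)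
    fix x :: real
    assume *: "x \<in> {x \<in> space lborel. (\<integral>\<^sup>+ v. \<phi> x * ennreal (sqrt (exp v) / (pi * (exp v + x\<^sup>2))) \<partial>N)
        \<noteq> \<phi> x * ennreal (alpha_cauchy_density \<alpha> x)}" and "x \<notin> {0}"
    define w where "w = 2 * ln \<bar>x\<bar>"
    have x: "\<bar>x\<bar> > 0" using \<open>x \<notin> {0}\<close> by simp
    have w: "exp w = x\<^sup>2"
      using x by (simp add: w_def exp_double)
    have "exp (\<alpha> / 2 * w) = \<bar>x\<bar> powr \<alpha>"
      using x by (simp add: w_def powr_def mult.commute)
    hence "(\<integral>\<^sup>+ v. ennreal (exp (v / 2) / (exp v + x\<^sup>2)) \<partial>N) = ennreal (sin (pi / \<alpha>) * \<alpha> / 2 / (1 + \<bar>x\<bar> powr \<alpha>))"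
      using mix[of w] by (simp only: w)
    moreover have "sqrt (exp v) = exp (v / 2)" for v :: real
      by (rule real_sqrt_unique) (auto simp flip: exp_double)
    hence "(\<integral>\<^sup>+ v. \<phi> x * ennreal (sqrt (exp v) / (pi * (exp v + x\<^sup>2))) \<partial>N)
        = (\<integral>\<^sup>+ v. \<phi> x * (ennreal (1 / pi) * ennreal (exp (v / 2) / (exp v + x\<^sup>2))) \<partial>N)"
      by (simp add: ennreal_mult'[symmetric])
    ultimately have "(\<integral>\<^sup>+ v. \<phi> x * ennreal (sqrt (exp v) / (pi * (exp v + x\<^sup>2))) \<partial>N)
        = \<phi> x * (ennreal (1 / pi) * ennreal (sin (pi / \<alpha>) * \<alpha> / 2 / (1 + \<bar>x\<bar> powr \<alpha>)))"
      by (simp add: nn_integral_cmult)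
    also have "ennreal (1 / pi) * ennreal (sin (pi / \<alpha>) * \<alpha> / 2 / (1 + \<bar>x\<bar> powr \<alpha>)) = ennreal (alpha_cauchy_density \<alpha> x)"
      using \<open>\<alpha> > 0\<close> by (subst ennreal_mult'[symmetric]) (auto simp: alpha_cauchy_density_def field_simps)
    finally show False using * by simp
  qed auto
  finally show ?thesis .
qed

section \<open>Independent coordinates and assembly of the factorization\<close>

text \<open>Coordinates 0 and 1 are split off the product one after the other. Keeping coordinate 2
  outermost makes it the conditioning variable, which is the role of \<open>T\<close> below.\<close>

lemma nn_integral_PiM_lessThan_3:
  fixes M :: "nat \<Rightarrow> 'a measure"
  assumes "\<And>i. sigma_finite_measure (M i)"
    and f [measurable]: "(\<lambda>(x, y, z). f x y z) \<in> borel_measurable (M 0 \<Otimes>\<^sub>M M 1 \<Otimes>\<^sub>M M 2)"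
  shows "(\<integral>\<^sup>+ \<omega>. f (\<omega> 0) (\<omega> 1) (\<omega> 2) \<partial>Pi\<^sub>M {..<3} M)
       = (\<integral>\<^sup>+ z. \<integral>\<^sup>+ y. \<integral>\<^sup>+ x. f x y z \<partial>M 0 \<partial>M 1 \<partial>M 2)"
proof -
  interpret product_sigma_finite M by (rule product_sigma_finite.intro) fact
  interpret M0: sigma_finite_measure "M 0" by fact
  interpret M1: sigma_finite_measure "M 1" by fact
  have I: "{..<3::nat} = insert 0 (insert 1 {2})" by auto
  have m1: "(\<lambda>\<omega>. f (\<omega> 0) (\<omega> 1) (\<omega> 2)) \<in> borel_measurable (Pi\<^sub>M (insert 0 (insert 1 {2})) M)"
  proof -
    have "(\<lambda>\<omega>. (\<omega> 0, \<omega> 1, \<omega> 2)) \<in> Pi\<^sub>M (insert 0 (insert 1 {2})) M \<rightarrow>\<^sub>M M 0 \<Otimes>\<^sub>M M 1 \<Otimes>\<^sub>M M 2"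
      by (intro measurable_Pair measurable_component_singleton) auto
    from measurable_compose[OF this f] show ?thesis by simp
  qed
  have m2: "(\<lambda>\<omega>. \<integral>\<^sup>+ x. f x (\<omega> 1) (\<omega> 2) \<partial>M 0) \<in> borel_measurable (Pi\<^sub>M (insert 1 {2}) M)"
  proof (rule sigma_finite_measure.borel_measurable_nn_integral[OF assms(1)])
    have "(\<lambda>p. (snd p, fst p 1, fst p 2)) \<in> Pi\<^sub>M (insert 1 {2}) M \<Otimes>\<^sub>M M 0 \<rightarrow>\<^sub>M M 0 \<Otimes>\<^sub>M M 1 \<Otimes>\<^sub>M M 2"
      by (intro measurable_Pair measurable_snd measurable_compose[OF measurable_fst measurable_component_singleton]) auto
    from measurable_compose[OF this f] show "(\<lambda>(\<omega>, x). f x (\<omega> 1) (\<omega> 2)) \<in> borel_measurable (Pi\<^sub>M (insert 1 {2}) M \<Otimes>\<^sub>M M 0)"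
      by (simp add: case_prod_beta)
  qed
  have [measurable]: "(\<lambda>p. f (snd p) (snd (fst p)) (fst (fst p))) \<in> borel_measurable ((M 2 \<Otimes>\<^sub>M M 1) \<Otimes>\<^sub>M M 0)"
  proof -
    have "(\<lambda>p. (snd p, snd (fst p), fst (fst p))) \<in> (M 2 \<Otimes>\<^sub>M M 1) \<Otimes>\<^sub>M M 0 \<rightarrow>\<^sub>M M 0 \<Otimes>\<^sub>M M 1 \<Otimes>\<^sub>M M 2"
      by measurable
    from measurable_compose[OF this f] show ?thesis by simp
  qed
  have "(\<integral>\<^sup>+ \<omega>. f (\<omega> 0) (\<omega> 1) (\<omega> 2) \<partial>Pi\<^sub>M {..<3} M)
      = (\<integral>\<^sup>+ \<omega>. \<integral>\<^sup>+ x. f x (\<omega> 1) (\<omega> 2) \<partial>M 0 \<partial>Pi\<^sub>M (insert 1 {2}) M)"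
    unfolding I using product_nn_integral_insert[OF _ _ m1] by simp
  also have "\<dots> = (\<integral>\<^sup>+ \<omega>. \<integral>\<^sup>+ y. \<integral>\<^sup>+ x. f x y (\<omega> 2) \<partial>M 0 \<partial>M 1 \<partial>Pi\<^sub>M {2} M)"
    using product_nn_integral_insert[OF _ _ m2] by simp
  also have "\<dots> = (\<integral>\<^sup>+ z. \<integral>\<^sup>+ y. \<integral>\<^sup>+ x. f x y z \<partial>M 0 \<partial>M 1 \<partial>M 2)"
    by (rule product_nn_integral_singleton) measurable
  finally show ?thesis .
qed

theorem lemma2p2:
  fixes \<alpha> :: real
  assumes "1 < \<alpha>" and "\<alpha> \<le> 2"
  shows "\<exists>(M :: (nat \<Rightarrow> real) measure) Z G T.
    prob_space M \<and>
    distributed M lborel Z (\<lambda>x. ennreal (std_normal_density x)) \<and>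
    distributed M lborel G (\<lambda>x. ennreal (gamma_density (1/2) x)) \<and>
    T \<in> borel_measurable M \<and>
    (AE \<omega> in M. 0 < T \<omega>) \<and>
    prob_space.indep_vars M (\<lambda>_. borel) (\<lambda>i. [Z, G, T] ! i) {..<3} \<and>
    (\<forall>s::real. -1/2 < s \<and> s < (\<alpha> - 1) / 2 \<longrightarrow>
       integrable M (\<lambda>\<omega>. T \<omega> powr s) \<and>
       prob_space.expectation M (\<lambda>\<omega>. T \<omega> powr s) =
         (Gamma (1/2) * Gamma (1/2)) / (Gamma (1/\<alpha>) * Gamma (1 - 1/\<alpha>)) *
         ((Gamma (1/\<alpha> + 2 * s / \<alpha>) * Gamma (1 - 1/\<alpha> - 2 * s / \<alpha>)) /
          (Gamma (1/2 + s) * Gamma (1/2 - s)))) \<and>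
    (\<exists>c>0. distributed M lborel (\<lambda>\<omega>. c * (Z \<omega> * sqrt (inverse (G \<omega>) * T \<omega>)))
       (\<lambda>x. ennreal (alpha_cauchy_density \<alpha> x)))"
proof -
  have \<alpha>: "\<alpha> > 0" "\<alpha> / 2 \<le> 1" using assms by auto
  have sin_pos: "sin (pi / \<alpha>) > 0"
    using assms by (intro sin_gt_zero) (auto simp: field_simps)
  \<comment> \<open>At \<open>\<alpha> = 2\<close> the constant
    \<open>sin (pi / \<alpha>) * \<alpha> / 2\<close> equals 1, as the degenerate case
    requires.\<close>
  obtain N :: "real measure" where N: "sigma_finite_measure N" and N_sets [measurable_cong]: "sets N = sets borel"
    and mix: "\<And>w. (\<integral>\<^sup>+ v. ennreal (exp (v / 2) / (exp v + exp w)) \<partial>N)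
                = ennreal (sin (pi / \<alpha>) * \<alpha> / 2 / (1 + exp (\<alpha> / 2 * w)))"
    using exists_log_mixture[of "\<alpha> / 2" "sin (pi / \<alpha>) * \<alpha> / 2"] \<alpha> sin_pos by auto
  define m where "m = (\<lambda>s. (Gamma (1/2) * Gamma (1/2)) / (Gamma (1/\<alpha>) * Gamma (1 - 1/\<alpha>)) *
         ((Gamma (1/\<alpha> + 2 * s / \<alpha>) * Gamma (1 - 1/\<alpha> - 2 * s / \<alpha>)) /
          (Gamma (1/2 + s) * Gamma (1/2 - s))))"
  \<comment> \<open>The range of \<open>s\<close> is what makes the Gamma arguments depending on
    \<open>s\<close> positive; for \<open>1/2 - s\<close> this uses
    \<open>\<alpha> \<le> 2\<close>.\<close>
  have m_pos: "m s > 0" if "-1/2 < s" "s < (\<alpha> - 1) / 2" for s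
  proof -
    have "1/\<alpha> + 2 * s / \<alpha> = (1 + 2 * s) / \<alpha>" "1 - 1/\<alpha> - 2 * s / \<alpha> = (\<alpha> - 1 - 2 * s) / \<alpha>"
      "1 - 1/\<alpha> = (\<alpha> - 1) / \<alpha>"
      using assms by (auto simp: field_simps)
    hence "1/\<alpha> + 2 * s / \<alpha> > 0" "1 - 1/\<alpha> - 2 * s / \<alpha> > 0" "1 - 1/\<alpha> > 0"
      using that assms by (simp_all only:) (auto intro!: divide_pos_pos)
    thus ?thesis unfolding m_def using that assms
      by (intro mult_pos_pos divide_pos_pos Gamma_real_pos) auto
  qed
  have moment: "(\<integral>\<^sup>+ v. ennreal (exp (s * v)) \<partial>N) = ennreal (m s)"
    if s: "-1/2 < s" "s < (\<alpha> - 1) / 2" for s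
  proof -
    \<comment> \<open>The Mellin formula with \<open>r = 1/2 + s\<close>, for which
      \<open>0 < r < \<alpha> / 2\<close> is exactly the range of \<open>s\<close>. Its constant
      \<open>sin (pi / \<alpha>)\<close> becomes the Gamma quotient by reflection and
      \<open>Gamma (1/2) * Gamma (1/2) = pi\<close>.\<close>
    have "(\<integral>\<^sup>+ v. ennreal (exp (((1/2 + s) - 1/2) * v)) \<partial>N)
       = ennreal (sin (pi / \<alpha>) * \<alpha> / 2 / (\<alpha> / 2) * (Gamma ((1/2 + s) / (\<alpha> / 2)) * Gamma (1 - (1/2 + s) / (\<alpha> / 2))) / (Gamma (1/2 + s) * Gamma (1 - (1/2 + s))))"
      using s assms sin_pos by (intro mellin_of_stieltjes_log N N_sets mix) auto
    also have "sin (pi / \<alpha>) * \<alpha> / 2 / (\<alpha> / 2) = (Gamma (1/2) * Gamma (1/2)) / (Gamma (1/\<alpha>) * Gamma (1 - 1/\<alpha>))"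
      using \<alpha> sin_pos Gamma_reflection_real[of "1/\<alpha>"] by (simp add: Gamma_one_half_real)
    also have "(1/2 + s) / (\<alpha> / 2) = 1/\<alpha> + 2 * s / \<alpha>"
      by (simp add: add_divide_distrib)
    also have "1 - (1/\<alpha> + 2 * s / \<alpha>) = 1 - 1/\<alpha> - 2 * s / \<alpha>" by simp
    also have "1 - (1/2 + s) = 1/2 - s" by simp
    finally show ?thesis by (simp add: m_def)
  qed
  have m0: "m 0 = 1"
  proof -
    have "Gamma (1/\<alpha>) > 0" "Gamma (1 - 1/\<alpha>) > 0" using assms by (auto intro!: Gamma_real_pos)
    thus ?thesis by (simp add: m_def Gamma_one_half_real)
  qed
  \<comment> \<open>The total mass of \<open>N\<close> is its moment at \<open>s = 0\<close>, which
    is in the admissible range because \<open>\<alpha> > 1\<close>.\<close>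
  have prob_N: "prob_space N"
    using moment[of 0] assms by (intro prob_spaceI) (simp add: m0)
  \<comment> \<open>All indices from 2 on carry the law of \<open>T = exp V\<close>, so that every
    \<open>P i\<close> is a probability measure.\<close>
  define P where "P = (\<lambda>i::nat. if i = 0 then density lborel (\<lambda>x. ennreal (std_normal_density x))
     else if i = 1 then density lborel (\<lambda>x. ennreal (gamma_density (1/2) x)) else distr N borel exp)"
  have P_eq: "P 0 = density lborel (\<lambda>x. ennreal (std_normal_density x))"
    "P 1 = density lborel (\<lambda>x. ennreal (gamma_density (1/2) x))" "P 2 = distr N borel exp"
    by (simp_all add: P_def)
  have prob_P: "prob_space (P i)" for i
    by (auto simp: P_def prob_space_normal_density prob_space_gamma_density intro!: prob_space.prob_space_distr prob_N)
  have sets_P [measurable_cong, simp]: "sets (P i) = sets borel" for i by (simp add: P_def)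
  define M where "M = Pi\<^sub>M {..<3::nat} P"
  interpret product_prob_space P "{..<3::nat}"
    by (intro product_prob_spaceI prob_P)
  have prob_M: "prob_space M" unfolding M_def by (rule prob_space_PiM) (rule prob_P)
  have coord: "(\<lambda>\<omega>. \<omega> i) \<in> borel_measurable M" if "i < 3" for i
  proof -
    have "(\<lambda>\<omega>. \<omega> i) \<in> M \<rightarrow>\<^sub>M P i"
      unfolding M_def using that by (intro measurable_component_singleton) auto
    also have "M \<rightarrow>\<^sub>M P i = M \<rightarrow>\<^sub>M borel" by (rule measurable_cong_sets) auto
    finally show ?thesis .
  qed
  define Z G T :: "(nat \<Rightarrow> real) \<Rightarrow> real" where "Z = (\<lambda>\<omega>. \<omega> 0)" and "G = (\<lambda>\<omega>. \<omega> 1)" and "T = (\<lambda>\<omega>. \<omega> 2)"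
  have [measurable]: "Z \<in> borel_measurable M" "G \<in> borel_measurable M" "T \<in> borel_measurable M"
    by (simp_all add: coord Z_def G_def T_def)
  have distr_M: "distr M borel (\<lambda>\<omega>. \<omega> i) = P i" if "i < 3" for i
  proof -
    have "distr M borel (\<lambda>\<omega>. \<omega> i) = distr M (P i) (\<lambda>\<omega>. \<omega> i)"
      by (rule distr_cong) auto
    also have "\<dots> = P i" unfolding M_def using that by (intro PiM_component) auto
    finally show ?thesis .
  qed
  have distr_eq: "distr M borel Z = density lborel (\<lambda>x. ennreal (std_normal_density x))"
    "distr M borel G = density lborel (\<lambda>x. ennreal (gamma_density (1/2) x))"
    "distr M borel T = distr N borel exp"
    unfolding Z_def G_def T_def P_eq[symmetric] by (simp_all add: distr_M)
  have nn_T: "(\<integral>\<^sup>+ \<omega>. ennreal (T \<omega> powr s) \<partial>M) = (\<integral>\<^sup>+ v. ennreal (exp (s * v)) \<partial>N)" for s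
  proof -
    have "(\<integral>\<^sup>+ \<omega>. ennreal (T \<omega> powr s) \<partial>M) = (\<integral>\<^sup>+ t. ennreal (t powr s) \<partial>distr M borel T)"
      by (rule nn_integral_distr[symmetric]) auto
    also have "\<dots> = (\<integral>\<^sup>+ v. ennreal (exp v powr s) \<partial>N)"
      unfolding distr_eq by (rule nn_integral_distr) auto
    finally show ?thesis by (simp add: exp_powr_real mult.commute)
  qed
  have "distributed M lborel Z (\<lambda>x. ennreal (std_normal_density x))"
    using distr_eq(1) by (simp add: distributed_def cong: distr_cong)
  moreover have "distributed M lborel G (\<lambda>x. ennreal (gamma_density (1/2) x))"
    using distr_eq(2) by (simp add: distributed_def cong: distr_cong)
  moreover have "T \<in> borel_measurable M" by measurable
  moreover have "AE \<omega> in M. 0 < T \<omega>"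
  proof -
    have "AE t in distr N borel exp. t > 0" by (subst AE_distr_iff) auto
    hence "AE t in distr M borel T. t > 0" by (simp only: distr_eq)
    thus ?thesis by (subst (asm) AE_distr_iff) auto
  qed
  moreover have "prob_space.indep_vars M (\<lambda>_. borel) (\<lambda>i. [Z, G, T] ! i) {..<3}"
  proof -
    interpret Q: prob_space M by fact
    have "{..<3::nat} \<noteq> {}" by (simp add: lessThan_empty_iff)
    hence "Q.indep_vars (\<lambda>_. borel) (\<lambda>i \<omega>. \<omega> i) {..<3}"
    proof (subst Q.indep_vars_iff_distr_eq_PiM')
      \<comment> \<open>Points of the product space are extensional on \<open>{..<3}\<close>, so
        restriction is the identity and the joint law of the coordinates is \<open>M\<close>
        itself.\<close>
      have "distr M (Pi\<^sub>M {..<3} (\<lambda>_. borel)) (\<lambda>\<omega>. \<lambda>i\<in>{..<3}. \<omega> i) = distr M M (\<lambda>\<omega>. \<omega>)"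
        by (rule distr_cong) (auto simp: M_def space_PiM PiE_restrict intro!: sets_PiM_cong)
      also have "\<dots> = Pi\<^sub>M {..<3} P" by (simp add: M_def)
      also have "\<dots> = Pi\<^sub>M {..<3} (\<lambda>i. distr M borel (\<lambda>\<omega>. \<omega> i))"
        by (intro PiM_cong) (auto simp: distr_M)
      finally show "distr M (Pi\<^sub>M {..<3} (\<lambda>_. borel)) (\<lambda>\<omega>. \<lambda>i\<in>{..<3}. \<omega> i)
          = Pi\<^sub>M {..<3} (\<lambda>i. distr M borel (\<lambda>\<omega>. \<omega> i))" .
    qed (use coord in auto)
    moreover have "[Z, G, T] ! i = (\<lambda>\<omega>. \<omega> i)" if "i \<in> {..<3}" for i :: nat
      using that by (auto simp: Z_def G_def T_def less_Suc_eq numeral_3_eq_3 numeral_2_eq_2)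
    ultimately show ?thesis
      by (subst Q.indep_vars_cong) auto
  qed
  moreover have "\<forall>s::real. -1/2 < s \<and> s < (\<alpha> - 1) / 2 \<longrightarrow>
       integrable M (\<lambda>\<omega>. T \<omega> powr s) \<and> prob_space.expectation M (\<lambda>\<omega>. T \<omega> powr s) = m s"
  proof (intro allI impI)
    fix s :: real assume s: "-1/2 < s \<and> s < (\<alpha> - 1) / 2"
    \<comment> \<open>A finite nonnegative integral yields integrability and the expectation at
      once.\<close>
    have "has_bochner_integral M (\<lambda>\<omega>. T \<omega> powr s) (m s)"
      using s m_pos[of s] by (intro has_bochner_integral_nn_integral) (auto simp: nn_T moment)
    thus "integrable M (\<lambda>\<omega>. T \<omega> powr s) \<and> prob_space.expectation M (\<lambda>\<omega>. T \<omega> powr s) = m s"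
      by (simp add: has_bochner_integral_iff)
  qed
  moreover have "distributed M lborel (\<lambda>\<omega>. 1 / sqrt 2 * (Z \<omega> * sqrt (inverse (G \<omega>) * T \<omega>)))
       (\<lambda>x. ennreal (alpha_cauchy_density \<alpha> x))"
  proof -
    let ?X = "\<lambda>z g t::real. 1 / sqrt 2 * (z * sqrt (inverse g * t))"
    have X [measurable]: "(\<lambda>\<omega>. ?X (Z \<omega>) (G \<omega>) (T \<omega>)) \<in> borel_measurable M" by measurable
    have [measurable]: "alpha_cauchy_density \<alpha> \<in> borel_measurable borel"
      unfolding alpha_cauchy_density_def[abs_def] by measurable
    have "distr M lborel (\<lambda>\<omega>. ?X (Z \<omega>) (G \<omega>) (T \<omega>)) = density lborel (\<lambda>x. ennreal (alpha_cauchy_density \<alpha> x))"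
    \<comment> \<open>On each Borel set: write the probability as an iterated integral with
      \<open>T\<close> outermost, replace the two inner integrals by the Cauchy density of scale
      \<open>sqrt (exp v)\<close>, and mix over \<open>N\<close>.\<close>
    proof (rule measure_eqI)
      fix A assume "A \<in> sets (distr M lborel (\<lambda>\<omega>. ?X (Z \<omega>) (G \<omega>) (T \<omega>)))"
      hence A [measurable]: "A \<in> sets borel" by simp
      have "emeasure (distr M lborel (\<lambda>\<omega>. ?X (Z \<omega>) (G \<omega>) (T \<omega>))) A
          = (\<integral>\<^sup>+ x. indicator A x \<partial>distr M lborel (\<lambda>\<omega>. ?X (Z \<omega>) (G \<omega>) (T \<omega>)))"
        by (rule nn_integral_indicator[symmetric]) auto
      also have "\<dots> = (\<integral>\<^sup>+ \<omega>. indicator A (?X (Z \<omega>) (G \<omega>) (T \<omega>)) \<partial>Pi\<^sub>M {..<3} P)"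
        by (subst nn_integral_distr) (auto simp: M_def[symmetric])
      also have "\<dots> = (\<integral>\<^sup>+ t. \<integral>\<^sup>+ g. \<integral>\<^sup>+ z. indicator A (?X z g t) \<partial>P 0 \<partial>P 1 \<partial>P 2)"
        unfolding Z_def G_def T_def by (rule nn_integral_PiM_lessThan_3) (auto intro: sigma_finite_measures)
      also have "\<dots> = (\<integral>\<^sup>+ v. \<integral>\<^sup>+ g. \<integral>\<^sup>+ z. indicator A (?X z g (exp v)) \<partial>P 0 \<partial>P 1 \<partial>N)"
        unfolding P_eq(3) by (rule nn_integral_distr) measurable
      also have "\<dots> = (\<integral>\<^sup>+ v. \<integral>\<^sup>+ x. indicator A x * ennreal (sqrt (exp v) / (pi * (exp v + x\<^sup>2))) \<partial>lborel \<partial>N)"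
        unfolding P_eq by (intro nn_integral_cong normal_over_sqrt_gamma) auto
      also have "\<dots> = (\<integral>\<^sup>+ x. indicator A x * ennreal (alpha_cauchy_density \<alpha> x) \<partial>lborel)"
        using \<alpha> by (intro alpha_cauchy_mixture N N_sets mix) auto
      also have "\<dots> = emeasure (density lborel (\<lambda>x. ennreal (alpha_cauchy_density \<alpha> x))) A"
        by (simp add: emeasure_density mult.commute)
      finally show "emeasure (distr M lborel (\<lambda>\<omega>. ?X (Z \<omega>) (G \<omega>) (T \<omega>))) A
          = emeasure (density lborel (\<lambda>x. ennreal (alpha_cauchy_density \<alpha> x))) A" .
    qed simp
    thus ?thesis by (simp add: distributed_def)
  qed
  ultimately show ?thesis
    using prob_M unfolding m_def
    by (intro exI[of _ M] exI[of _ Z] exI[of _ G] exI[of _ T] conjI exI[of _ "1 / sqrt 2"]) auto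
qed

end
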